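(* Let $f:[a,b]\to[c,d]\subseteq\overline{\mathbb{R}}$ be a continuous and invertible function, with $a\geq-\infty$ and $b\leq+\infty$. Then $f$ and $f^{-1}$ have antiderivatives (in $[a,b]$ and $[c,d]$ respectively), and if $F$ is an antiderivative of $f$, then the antiderivative of $f^{-1}$ is $$G(x)=x\,f^{-1}(x)-F\circ f^{-1}(x)+C.$$
   Context: $\overline{\mathbb{R}}=[-\infty,+\infty]$ denotes the extended real line. The function $f^{-1}:[c,d]\to[a,b]$ is the inverse function of $f$. An antiderivative of a function is a function whose derivative is the given function, and $C$ denotes the (real) constant of integration. Neither $f$ nor $f^{-1}$ is assumed to be differentiable.
   Formalization: "Antiderivative in [a,b]" (and in [c,d]) and the formula for G are required only at finite points where the function's value is finite; at infinite endpoints or values the derivative or the formula is undefined (e.g. f(x)=1/x on [0,1]). *)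

theory Defs
  imports Complex_Main "HOL-Library.Extended_Real"
begin

text \<open>
  The derivative of a real-valued function can only be required to equal \<open>f x\<close> where both
  \<open>x\<close> and \<open>f x\<close> are real.  If \<open>f\<close> is continuous and injective on
  \<open>{a..b}\<close>, this leaves out at most the endpoints: \<open>a\<close> or \<open>b\<close> when infinite, or when
  \<open>f\<close> is infinite there (as \<open>1 / x\<close> on \<open>{0..1}\<close>, whose antiderivative \<open>ln x\<close> has no
  finite limit at \<open>0\<close>).
\<close>

definition finite_part :: "(ereal \<Rightarrow> ereal) \<Rightarrow> ereal set \<Rightarrow> real set" where
  "finite_part f S = {x. ereal x \<in> S \<and> \<bar>f (ereal x)\<bar> \<noteq> \<infinity>}"

text \<open>
  The derivative is taken within \<^const>\<open>finite_part\<close>, hence is one-sided at an endpoint that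
  belongs to it.  The values of \<open>F\<close> elsewhere are irrelevant.
\<close>

definition antiderivative_on :: "(real \<Rightarrow> real) \<Rightarrow> (ereal \<Rightarrow> ereal) \<Rightarrow> ereal set \<Rightarrow> bool" where
  "antiderivative_on F f S \<longleftrightarrow>
     (\<forall>x \<in> finite_part f S.
        (F has_real_derivative real_of_ereal (f (ereal x))) (at x within finite_part f S))"

end

theory Submission
  imports Defs "HOL-Analysis.Interval_Integral"
begin

text \<open>
  Write \<open>g\<close> for the inverse of \<open>f\<close> and let \<open>F' = f\<close>.  With \<open>G y = y * g y - F (g y)\<close>, the mean
  value theorem gives
  \<open>G y' - G y - (y' - y) * g y = (y' - f \<xi>) * (g y' - g y)\<close> for some \<open>\<xi>\<close> between \<open>g y\<close> and
  \<open>g y'\<close>.  A continuous injection is monotone, so \<open>f \<xi>\<close> lies between \<open>y\<close> and \<open>y'\<close>, and the right-hand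
  side is at most \<open>\<bar>y' - y\<bar> * \<bar>g y' - g y\<bar>\<close>, which is \<open>o(y' - y)\<close> by continuity of \<open>g\<close>.
\<close>

text \<open>\<open>A\<close> may be open, half-open or unbounded, while the fundamental theorem of
  calculus is applied on compact intervals. So the integral from a fixed \<open>x0\<close> is
  differentiated at each \<open>x\<close> on a compact \<open>{u..v}\<close> inside \<open>A\<close>
  that contains \<open>x0\<close> and is a neighbourhood of \<open>x\<close> relative to
  \<open>A\<close>.\<close>

lemma continuous_on_interval_antiderivative:
  fixes f :: "real \<Rightarrow> real"
  assumes A: "is_interval A" and f: "continuous_on A f"
  shows "\<exists>F. \<forall>x\<in>A. (F has_real_derivative f x) (at x within A)"
proof (cases "A = {}")
  case False
  then obtain x0 where x0: "x0 \<in> A" by blast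
  have "((\<lambda>u. LBINT y=ereal x0..ereal u. f y) has_real_derivative f x) (at x within A)" if x: "x \<in> A" for x
  proof -
    \<comment> \<open>If \<open>u\<close> is not strictly left of \<open>x\<close>, then
      \<open>u = x\<close> is the least point of \<open>A\<close>, so \<open>{u..v}\<close> loses
      nothing of \<open>A\<close> near \<open>x\<close> on that side. The choice of \<open>v\<close>
      mirrors this.\<close>
    obtain u where u: "u \<in> A" "u \<le> x" "u \<le> x0" and u': "u < x \<or> A \<subseteq> {u..}"
    proof (cases "\<exists>p\<in>A. p < min x x0")
      case True
      then show ?thesis using that by auto
    next
      case False
      then have "A \<subseteq> {min x x0..}" by (auto simp: not_less)
      moreover have "min x x0 \<in> A" using x x0 by (simp add: min_def)
      ultimately show ?thesis by (intro that[of "min x x0"]) auto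
    qed
    obtain v where v: "v \<in> A" "x \<le> v" "x0 \<le> v" and v': "x < v \<or> A \<subseteq> {..v}"
    proof (cases "\<exists>p\<in>A. max x x0 < p")
      case True
      then show ?thesis using that by auto
    next
      case False
      then have "A \<subseteq> {..max x x0}" by (auto simp: not_less)
      moreover have "max x x0 \<in> A" using x x0 by (simp add: max_def)
      ultimately show ?thesis by (intro that[of "max x x0"]) auto
    qed
    have uv: "{u..v} \<subseteq> A"
      using A u(1) v(1) by (meson atLeastAtMost_iff is_interval_1 subsetI)
    \<comment> \<open>The open set \<open>S\<close> cuts only on the sides where \<open>A\<close>
      may extend past \<open>u\<close> or \<open>v\<close>.\<close>
    define S where "S = (if u < x then {u<..} else UNIV) \<inter> (if x < v then {..<v} else UNIV)"
    have "at x within A = at x within {u..v}"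
    proof (rule at_within_nhd)
      show "x \<in> S" "open S" by (auto simp: S_def)
      show "A \<inter> S - {x} = {u..v} \<inter> S - {x}"
        using uv u' v' by (fastforce simp: S_def split: if_splits)
    qed
    moreover have "((\<lambda>w. LBINT y=ereal x0..ereal w. f y) has_vector_derivative f x) (at x within {u..v})"
      using u v continuous_on_subset[OF f uv] by (intro interval_integral_FTC2) auto
    ultimately show ?thesis
      by (simp add: has_real_derivative_iff_has_vector_derivative)
  qed
  then show ?thesis by blast
qed simp

lemma has_real_derivative_inverse_antiderivative:
  fixes f g F :: "real \<Rightarrow> real"
  assumes A: "is_interval A" and f: "continuous_on A f" "inj_on f A"
    and g: "continuous_on B g" "g ` B \<subseteq> A" "\<And>y. y \<in> B \<Longrightarrow> f (g y) = y"
    and F: "\<And>x. x \<in> A \<Longrightarrow> (F has_real_derivative f x) (at x within A)"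
    and y: "y \<in> B"
  shows "((\<lambda>y. y * g y - F (g y)) has_real_derivative g y) (at y within B)"
proof -
  let ?G = "\<lambda>y. y * g y - F (g y)"
  \<comment> \<open>\<open>min\<close> and \<open>max\<close> cover increasing and decreasing
    \<open>f\<close> at once.\<close>
  have mvt: "\<exists>t. F v - F u = f t * (v - u) \<and> min (f u) (f v) \<le> f t \<and> f t \<le> max (f u) (f v)"
    if uv: "u \<in> A" "v \<in> A" "u < v" for u v
  proof -
    have sub: "{u..v} \<subseteq> A"
      using A uv by (meson atLeastAtMost_iff is_interval_1 subsetI)
    have "\<exists>t\<in>{u<..<v}. F v - F u = f t * (v - u)"
    proof (rule mvt_simple[OF \<open>u < v\<close>])
      fix x assume "u \<le> x" "x \<le> v"
      then show "(F has_derivative (*) (f x)) (at x within {u..v})"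
        using has_field_derivative_subset[OF F sub] sub by (auto simp: has_field_derivative_def)
    qed
    then obtain t where t: "u < t" "t < v" "F v - F u = f t * (v - u)" by auto
    have "f u < f t \<and> f t < f v \<or> f v < f t \<and> f t < f u"
      by (rule continuous_inj_imp_mono[OF t(1,2) continuous_on_subset[OF f(1) sub] inj_on_subset[OF f(2) sub]])
    with t(3) show ?thesis by (intro exI[of _ t]) auto
  qed
  have bound: "\<bar>(?G z - ?G y) / (z - y) - g y\<bar> \<le> \<bar>g z - g y\<bar>" if z: "z \<in> B" "z \<noteq> y" for z
  proof -
    have "g z \<noteq> g y" using g(3) z y by metis
    \<comment> \<open>Here \<open>t\<close> is the mean value \<open>f \<xi>\<close>, not the point
      \<xi>. If \<open>g z < g y\<close>, the endpoints are swapped and both sides change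
      sign.\<close>
    have "\<exists>t. F (g z) - F (g y) = t * (g z - g y) \<and> min y z \<le> t \<and> t \<le> max y z"
    proof (cases "g y < g z")
      case True
      then show ?thesis using mvt[of "g y" "g z"] g z y by auto
    next
      case False
      then obtain t where "F (g y) - F (g z) = f t * (g y - g z)" "min y z \<le> f t" "f t \<le> max y z"
        using mvt[of "g z" "g y"] g z y \<open>g z \<noteq> g y\<close> by (auto simp: min.commute max.commute)
      then show ?thesis by (intro exI[of _ "f t"]) (auto simp: algebra_simps)
    qed
    then obtain t where t: "F (g z) - F (g y) = t * (g z - g y)" "min y z \<le> t" "t \<le> max y z" by blast
    have "?G z - ?G y - (z - y) * g y = (z - t) * (g z - g y)"
      using t(1) by (simp add: algebra_simps)
    then have "(?G z - ?G y) / (z - y) - g y = (z - t) / (z - y) * (g z - g y)"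
      using z(2) by (simp add: field_simps)
    moreover have "\<bar>(z - t) / (z - y)\<bar> \<le> 1"
      using t z(2) by (auto simp: abs_le_iff divide_simps min_def max_def split: if_splits)
    then have "\<bar>(z - t) / (z - y)\<bar> * \<bar>g z - g y\<bar> \<le> \<bar>g z - g y\<bar>"
      by (intro mult_left_le_one_le) auto
    ultimately show ?thesis
      by (simp only: abs_mult)
  qed
  have "((\<lambda>z. g z - g y) \<longlongrightarrow> 0) (at y within B)"
    using g(1) y by (simp add: continuous_on_def LIM_zero)
  then have "((\<lambda>z. \<bar>g z - g y\<bar>) \<longlongrightarrow> 0) (at y within B)"
    by (rule tendsto_rabs_zero)
  then have "((\<lambda>z. (?G z - ?G y) / (z - y) - g y) \<longlongrightarrow> 0) (at y within B)"
    by (rule Lim_null_comparison[rotated]) (use bound in \<open>auto simp: eventually_at_filter\<close>)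
  then show ?thesis
    by (simp add: has_field_derivative_iff LIM_zero_iff)
qed

text \<open>By strict monotonicity, the value at a point between two points of the finite part lies
  strictly between two finite values.\<close>

lemma is_interval_finite_part:
  assumes f: "continuous_on {a..b} f" "inj_on f {a..b}"
  shows "is_interval (finite_part f {a..b})"
  unfolding is_interval_1
proof (intro ballI allI impI)
  fix x y z
  assume x: "x \<in> finite_part f {a..b}" and y: "y \<in> finite_part f {a..b}" and z: "x \<le> z \<and> z \<le> y"
  have sub: "{ereal x..ereal y} \<subseteq> {a..b}"
    using x y by (auto simp: finite_part_def intro: order_trans)
  show "z \<in> finite_part f {a..b}"
  proof (cases "z = x \<or> z = y")
    case False
    then have z: "x < z" "z < y" using z by auto
    have "f (ereal x) < f (ereal z) \<and> f (ereal z) < f (ereal y) \<or>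
          f (ereal y) < f (ereal z) \<and> f (ereal z) < f (ereal x)"
      by (rule continuous_inj_imp_mono[OF _ _ continuous_on_subset[OF f(1) sub] inj_on_subset[OF f(2) sub]])
         (use z in auto)
    then have "\<bar>f (ereal z)\<bar> \<noteq> \<infinity>" by auto
    moreover have "ereal z \<in> {a..b}" using z by (intro subsetD[OF sub]) simp
    ultimately show ?thesis by (simp add: finite_part_def)
  qed (use x y in auto)
qed

lemma continuous_on_finite_part:
  assumes "continuous_on S f"
  shows "continuous_on (finite_part f S) (\<lambda>x. real_of_ereal (f (ereal x)))"
proof -
  have "continuous_on (finite_part f S) (\<lambda>x. f (ereal x))"
    by (rule continuous_on_compose2[OF assms]) (auto simp: finite_part_def intro!: continuous_intros)
  then show ?thesis
    by (rule continuous_on_compose2[OF continuous_on_real]) (auto simp: finite_part_def)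
qed

text \<open>\<open>real_of_ereal\<close> sends both infinities to 0, but it is injective on finite
  values.\<close>

lemma inj_on_finite_part:
  assumes "inj_on f S"
  shows "inj_on (\<lambda>x. real_of_ereal (f (ereal x))) (finite_part f S)"
proof (rule inj_onI)
  fix x y
  assume "x \<in> finite_part f S" "y \<in> finite_part f S"
    and "real_of_ereal (f (ereal x)) = real_of_ereal (f (ereal y))"
  then have "f (ereal x) = f (ereal y)" "ereal x \<in> S" "ereal y \<in> S"
    by (auto simp: finite_part_def)
  with assms show "x = y" by (auto dest: inj_onD)
qed

text \<open>The finite parts of \<open>f\<close> and of its inverse correspond: both describe the
  points of the graph of \<open>f\<close> with two finite coordinates.\<close>

lemma inv_into_finite_part:
  assumes f: "bij_betw f S T" and y: "y \<in> finite_part (inv_into S f) T"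
  defines "x \<equiv> real_of_ereal (inv_into S f (ereal y))"
  shows "x \<in> finite_part f S" "real_of_ereal (f (ereal x)) = y"
proof -
  have x: "ereal x = inv_into S f (ereal y)" and T: "ereal y \<in> T"
    using y by (auto simp: finite_part_def x_def ereal_real')
  have "f (ereal x) = ereal y" "ereal x \<in> S"
    unfolding x using f T by (auto simp: bij_betw_inv_into_right bij_betw_def inv_into_into)
  then show "x \<in> finite_part f S" "real_of_ereal (f (ereal x)) = y"
    by (auto simp: finite_part_def)
qed

theorem theorem0p1:
  fixes f :: "ereal \<Rightarrow> ereal" and a b c d :: ereal
  assumes "continuous_on {a..b} f"
    and "bij_betw f {a..b} {c..d}"
  defines "g \<equiv> inv_into {a..b} f"
  shows "(\<exists>F. antiderivative_on F f {a..b}) \<and>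
         (\<exists>G. antiderivative_on G g {c..d}) \<and>
         (\<forall>F. antiderivative_on F f {a..b} \<longrightarrow>
            (\<forall>G. antiderivative_on G g {c..d} \<longleftrightarrow>
               (\<exists>C::real. \<forall>x \<in> finite_part g {c..d}.
                  G x = x * real_of_ereal (g (ereal x)) - F (real_of_ereal (g (ereal x))) + C)))"
proof -
  define A where "A = finite_part f {a..b}"
  define B where "B = finite_part g {c..d}"
  define \<psi> where "\<psi> = (\<lambda>y. real_of_ereal (g (ereal y)))"
  have f: "inj_on f {a..b}" "f ` {a..b} = {c..d}"
    using assms(2) by (auto simp: bij_betw_def)
  \<comment> \<open>The extended line is compact, so this holds for infinite endpoints too;
    compactness makes the inverse continuous.\<close>
  have "compact {a..b}"
    using compact_Int_closed[OF compact_UNIV closed_atLeastAtMost[of a b]] by simp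
  then have g: "continuous_on {c..d} g" "inj_on g {c..d}"
    using continuous_on_inv[OF assms(1), of g] f inj_on_inv_into[of "{c..d}" f "{a..b}"]
    by (auto simp: g_def)
  have A: "is_interval A" and B: "is_interval B"
    unfolding A_def B_def using assms(1) f g by (auto intro: is_interval_finite_part)
  have deriv: "((\<lambda>y. y * \<psi> y - F (\<psi> y)) has_real_derivative \<psi> y) (at y within B)"
    if "antiderivative_on F f {a..b}" "y \<in> B" for F y
  proof (rule has_real_derivative_inverse_antiderivative[OF A, where f = "\<lambda>x. real_of_ereal (f (ereal x))"])
    show "continuous_on A (\<lambda>x. real_of_ereal (f (ereal x)))"
      unfolding A_def by (rule continuous_on_finite_part[OF assms(1)])
    show "inj_on (\<lambda>x. real_of_ereal (f (ereal x))) A"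
      unfolding A_def by (rule inj_on_finite_part[OF f(1)])
    show "continuous_on B \<psi>"
      unfolding B_def \<psi>_def by (rule continuous_on_finite_part[OF g(1)])
    show "\<psi> ` B \<subseteq> A"
      using inv_into_finite_part(1)[OF assms(2)] by (auto simp: A_def B_def \<psi>_def g_def)
    show "real_of_ereal (f (ereal (\<psi> z))) = z" if "z \<in> B" for z
      using inv_into_finite_part(2)[OF assms(2)] that by (simp add: B_def \<psi>_def g_def)
    show "(F has_real_derivative real_of_ereal (f (ereal x))) (at x within A)" if "x \<in> A" for x
      using \<open>antiderivative_on F f {a..b}\<close> that by (simp add: antiderivative_on_def A_def)
  qed fact
  have iff: "antiderivative_on G g {c..d} \<longleftrightarrow> (\<exists>C. \<forall>y\<in>B. G y = y * \<psi> y - F (\<psi> y) + C)"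
    if F: "antiderivative_on F f {a..b}" for F G
  proof
    assume "antiderivative_on G g {c..d}"
    then have "((\<lambda>y. G y - (y * \<psi> y - F (\<psi> y))) has_real_derivative 0) (at y within B)" if "y \<in> B" for y
      using DERIV_diff[OF _ deriv[OF F that], of G "\<psi> y"] that
      by (simp add: antiderivative_on_def B_def[symmetric] \<psi>_def)
    \<comment> \<open>A single constant suffices because \<open>B\<close> is an interval.\<close>
    then obtain C where "\<forall>y\<in>B. G y - (y * \<psi> y - F (\<psi> y)) = C"
      using has_field_derivative_zero_constant[OF is_interval_convex[OF B], of "\<lambda>y. G y - (y * \<psi> y - F (\<psi> y))"]
      by auto
    then show "\<exists>C. \<forall>y\<in>B. G y = y * \<psi> y - F (\<psi> y) + C"
      by (intro exI[of _ C]) (auto simp: algebra_simps)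
  next
    assume "\<exists>C. \<forall>y\<in>B. G y = y * \<psi> y - F (\<psi> y) + C"
    then obtain C where C: "\<And>y. y \<in> B \<Longrightarrow> G y = y * \<psi> y - F (\<psi> y) + C" by blast
    have "(G has_real_derivative \<psi> y) (at y within B)" if y: "y \<in> B" for y
    \<comment> \<open>\<open>G\<close> is known only on \<open>B\<close>, which is enough for a
      derivative within \<open>B\<close>.\<close>
    proof (rule has_field_derivative_transform_within[OF _ zero_less_one y])
      show "((\<lambda>y. y * \<psi> y - F (\<psi> y) + C) has_real_derivative \<psi> y) (at y within B)"
        using DERIV_add[OF deriv[OF F y] DERIV_const[of C]] by simp
    qed (simp add: C)
    then show "antiderivative_on G g {c..d}"
      by (simp add: antiderivative_on_def B_def \<psi>_def)
  qed
  obtain F where F: "antiderivative_on F f {a..b}"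
    using continuous_on_interval_antiderivative[OF A[unfolded A_def] continuous_on_finite_part[OF assms(1)]]
    by (auto simp: antiderivative_on_def)
  \<comment> \<open>Existence for \<open>g\<close> comes from the formula with \<open>C = 0\<close>,
    without integrating \<open>g\<close>.\<close>
  have G: "antiderivative_on (\<lambda>y. y * \<psi> y - F (\<psi> y)) g {c..d}"
    unfolding iff[OF F] by (intro exI[of _ 0]) simp
  show ?thesis
  proof (intro conjI allI impI)
    show "\<exists>F. antiderivative_on F f {a..b}" by (rule exI) (rule F)
    show "\<exists>G. antiderivative_on G g {c..d}" by (rule exI) (rule G)
  qed (rule iff[unfolded B_def \<psi>_def])
qed

end
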